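(* Let $\mathbf L=(L,\vee,\wedge,{}')$ be a lattice with a unary operation $'$. Then the following are equivalent: (i) for all $x,y\in L$, $(x\vee y)'=x'\wedge y'$ and $(x\wedge y)'=x'\vee y'$; (ii) the operation $'$ is antitone and, for all $x,y\in L$, $(x\vee y)'\wedge x'=x'\wedge y'$ and $(x\wedge y)'\vee x'=x'\vee y'$.
   Context: The lattice is not assumed to be bounded and $'$ is an arbitrary unary operation on $L$. The operation $'$ is called antitone if, for all $x,y\in L$, $x\le y$ implies $y'\le x'$. *)

theory Defs
  imports Main
begin

end

theory Submission
  imports Defs
begin

text \<open>
  The two displayed identities of the second condition are the De Morgan laws weakened by an extra
  meet or join with \<open>c x\<close>. For antitone \<open>c\<close> this extra operand is absorbed, because
  \<open>c (sup x y) \<le> c x \<le> c (inf x y)\<close>, so the weakened laws and the De Morgan laws coincide.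
  Conversely, the De Morgan law for joins alone forces antitonicity: when \<open>x \<le> y\<close>, it reads
  \<open>c y = inf (c x) (c y)\<close>.
\<close>

theorem theorem4p2:
  fixes c :: "'a::lattice \<Rightarrow> 'a"
  shows "(\<forall>x y. c (sup x y) = inf (c x) (c y) \<and> c (inf x y) = sup (c x) (c y)) \<longleftrightarrow>
    (antimono c \<and>
     (\<forall>x y. inf (c (sup x y)) (c x) = inf (c x) (c y) \<and>
            sup (c (inf x y)) (c x) = sup (c x) (c y)))"
proof -
  have absorb: "inf (c (sup x y)) (c x) = c (sup x y) \<and> sup (c (inf x y)) (c x) = c (inf x y)"
    if "antimono c" for x y
    using antimonoD[OF that sup_ge1[of x y]] antimonoD[OF that inf_le1[of x y]]
    by (simp add: inf_absorb1 sup_absorb1)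
  have "antimono c" if de_morgan: "\<forall>x y. c (sup x y) = inf (c x) (c y)"
  proof (rule antimonoI)
    fix x y :: 'a
    assume "x \<le> y"
    then have "c y = inf (c x) (c y)"
      using de_morgan by (metis sup_absorb2)
    then show "c y \<le> c x"
      by (metis inf_le1)
  qed
  with absorb show ?thesis
    by metis
qed

end
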